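(* Let $\Sigma\in\mathbb C^{p\times p}$ be a full rank Hermitian covariance matrix and $M$ a fixed $p\times p$ matrix as in the definition of $W(n)=W_p(n,\Sigma,M)$; let $\widehat W(n)=W_p(n,\Sigma,0)$. The sequence $\{E(\mathrm{Tr}[\widehat W(n)]^k)\}_k$ is the binomial sequence associated to $\{E(\mathrm{Tr}[W(n)]^k)\}_k$; that is, if $\{s_k(x)\}$ is the Sheffer polynomial sequence with $E(\mathrm{Tr}[W(n)]^k)=s_k(n)$, and $\{p_k(x)\}$ is its associated sequence, then $E(\mathrm{Tr}[\widehat W(n)]^k)=p_k(n)$ for all $k\ge0$ and all nonnegative integers $n$.
   Context: $W_p(n,\Sigma,M)=\sum_{i=1}^n(X_{(i)}-\boldsymbol m_i)^\dagger(X_{(i)}-\boldsymbol m_i)$, where $X_{(1)},\ldots,X_{(n)}$ are independent $p$-variate (circularly symmetric) complex normal row vectors with zero mean and full rank Hermitian covariance $\Sigma$ (so $E[X_{(i)}^\dagger X_{(i)}]=\Sigma$), and $\boldsymbol m_1,\ldots,\boldsymbol m_n$ are row vectors of dimension $p$ with $\sum_i\boldsymbol m_i^\dagger\boldsymbol m_i=M$. The central case is $M=0$ (all $\boldsymbol m_i=0$). A Sheffer polynomial sequence $\{s_k(x)\}_{k\ge0}$ is one with $\sum_{k\ge0}s_k(x)\frac{z^k}{k!}=g(z)\exp[xf(z)]$, for formal power series with $g(0)=1$, $f(0)=0$, $f'(0)\neq0$. Its associated sequence $\{p_k(x)\}$ is given by $\sum_{k\ge0}p_k(x)\frac{z^k}{k!}=\exp[xf(z)]$;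 it is of binomial type, i.e. $p_k(x+y)=\sum_{j=0}^k\binom kj p_j(x)p_{k-j}(y)$. The sequence $\{E(\mathrm{Tr}[W(n)]^k)\}_k$, for fixed $\Sigma,M$, is of Sheffer type in $n$: there is a unique Sheffer polynomial sequence $\{s_k(x)\}$ with $E(\mathrm{Tr}[W(n)]^k)=s_k(n)$ for all $k$ and all $n$ for which $W_p(n,\Sigma,M)$ is defined. *)

theory Defs
  imports
    "HOL-Probability.Probability"
    "HOL-Computational_Algebra.Computational_Algebra"
begin

text \<open>
  Elements of \<^typ>\<open>complex ^ 'p\<close> are read as row vectors, and the dagger of the literature is the
  conjugate transpose.
\<close>

definition gram :: "complex ^ 'p \<Rightarrow> complex ^ 'p ^ 'p"
  where \<comment> \<open>the matrix \<open>v\<^sup>\<dagger> v\<close>\<close>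
  "gram v = (\<chi> i j. cnj (vec_nth v i) * vec_nth v j)"

definition sesq :: "complex ^ 'p ^ 'p \<Rightarrow> complex ^ 'p \<Rightarrow> complex"
  where \<comment> \<open>the number \<open>v A v\<^sup>\<dagger>\<close>\<close>
  "sesq A v = (\<Sum>i\<in>UNIV. \<Sum>j\<in>UNIV. vec_nth v i * vec_nth (vec_nth A i) j * cnj (vec_nth v j))"

definition full_rank_covariance :: "complex ^ 'p ^ 'p \<Rightarrow> bool"
  where
  "full_rank_covariance S \<longleftrightarrow>
     (\<forall>i j. vec_nth (vec_nth S i) j = cnj (vec_nth (vec_nth S j) i)) \<and>
     (\<forall>v. 0 \<le> Re (sesq S v)) \<and>
     rank S = CARD('p)"

text \<open>
  The circularly symmetric complex normal law with mean zero and covariance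
  \<open>E[X\<^sup>\<dagger> X] = S\<close>, given by its density with respect to Lebesgue measure on \<open>\<complex>\<^sup>p = \<real>\<^sup>2\<^sup>p\<close>.
  For a row vector with this convention the exponent is \<open>- x S\<^sup>-\<^sup>1 x\<^sup>\<dagger>\<close>. If \<open>S\<close> is
  a full rank covariance matrix, then \<open>x S\<^sup>-\<^sup>1 x\<^sup>\<dagger>\<close> and \<open>det S\<close> are real, so taking real parts
  only adjusts the type.
\<close>

definition complex_normal_density :: "complex ^ 'p ^ 'p \<Rightarrow> complex ^ 'p \<Rightarrow> real"
  where
  "complex_normal_density S x =
     exp (- Re (sesq (matrix_inv S) x)) / (pi ^ CARD('p) * Re (det S))"

definition wishart_defined :: "nat \<Rightarrow> complex ^ 'p ^ 'p \<Rightarrow> bool"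
  where \<comment> \<open>\<open>M\<close> is an admissible parameter for \<open>n\<close> degrees of freedom\<close>
  "wishart_defined n M \<longleftrightarrow> (\<exists>m :: nat \<Rightarrow> complex ^ 'p. (\<Sum>i<n. gram (m i)) = M)"

definition wishart ::
    "'w measure \<Rightarrow> ('w \<Rightarrow> complex ^ 'p ^ 'p) \<Rightarrow> nat \<Rightarrow> complex ^ 'p ^ 'p \<Rightarrow> complex ^ 'p ^ 'p \<Rightarrow> bool"
  where \<comment> \<open>\<open>W\<close> is a random matrix \<open>W\<^sub>p(n, S, M)\<close> on the probability space \<open>\<Omega>\<close>\<close>
  "wishart \<Omega> W n S M \<longleftrightarrow>
     prob_space \<Omega> \<and>
     (\<exists>(X :: nat \<Rightarrow> 'w \<Rightarrow> complex ^ 'p) (m :: nat \<Rightarrow> complex ^ 'p).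
        prob_space.indep_vars \<Omega> (\<lambda>_. borel) X {..<n} \<and>
        (\<forall>i<n. distributed \<Omega> lborel (X i) (\<lambda>x. ennreal (complex_normal_density S x))) \<and>
        (\<Sum>i<n. gram (m i)) = M \<and>
        (\<forall>\<omega>\<in>space \<Omega>. W \<omega> = (\<Sum>i<n. gram (X i \<omega> - m i))))"

definition sheffer_for :: "(nat \<Rightarrow> complex poly) \<Rightarrow> complex fps \<Rightarrow> complex fps \<Rightarrow> bool"
  where
  "sheffer_for s g f \<longleftrightarrow>
     fps_nth g 0 = 1 \<and> fps_nth f 0 = 0 \<and> fps_nth f 1 \<noteq> 0 \<and>
     (\<forall>x. Abs_fps (\<lambda>k. poly (s k) x / fact k) = g * (fps_exp x oo f))"

definition sheffer_sequence :: "(nat \<Rightarrow> complex poly) \<Rightarrow> bool"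
  where
  "sheffer_sequence s \<longleftrightarrow> (\<exists>g f. sheffer_for s g f)"

definition associated_sequence :: "(nat \<Rightarrow> complex poly) \<Rightarrow> (nat \<Rightarrow> complex poly) \<Rightarrow> bool"
  where \<comment> \<open>\<open>p\<close> is the associated sequence of \<open>s\<close>; \<open>g\<close> and \<open>f\<close> are determined by \<open>s\<close>\<close>
  "associated_sequence p s \<longleftrightarrow> (\<exists>g f. sheffer_for s g f \<and> sheffer_for p 1 f)"

end

theory Submission
  imports Defs
begin

text \<open>
  The shift \<open>m\<close> enters the moment generating function of \<open>\<parallel>X - m\<parallel>\<^sup>2\<close> only through a factor: for
  small real \<open>z\<close>, completing the square and translation invariance of Lebesgue measure give
  \<open>E exp (z \<parallel>X - m\<parallel>\<^sup>2) = E exp (z \<parallel>X\<parallel>\<^sup>2) \<cdot> exp (l\<^sub>z (m\<^sup>\<dagger> m))\<close> with \<open>l\<^sub>z\<close> linear. By independence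
  \<open>E exp (z Tr W(n)) = \<phi>(z)\<^sup>n exp (l\<^sub>z M)\<close>, where \<open>\<phi>(z) = E exp (z \<parallel>X\<parallel>\<^sup>2)\<close> belongs to the central case
  with one degree of freedom. Comparing \<open>n + 1\<close> with \<open>n\<close> in the Sheffer generating function
  \<open>g(z) exp (n f(z))\<close> forces \<open>\<phi> = exp f\<close>, and \<open>\<phi>\<^sup>n = exp (n f)\<close> is the generating function of the
  associated sequence at \<open>n\<close>. No value of \<open>\<phi>\<close>, hence no determinant, is needed.
\<close>

section \<open>Power series and moments\<close>

text \<open>The sum tends to the constant coefficient at 0, so that coefficient vanishes; dividing
  by \<open>x\<close> passes to the shifted sequence. Because of this division the hypothesis speaks
  of \<open>x \<noteq> 0\<close> only: that form survives the induction.\<close>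

lemma powser_sums_zero_imp_coeff_zero:
  fixes a :: "nat \<Rightarrow> real"
  assumes "0 < r" and "\<And>x. x \<noteq> 0 \<Longrightarrow> norm x < r \<Longrightarrow> (\<lambda>n. a n * x ^ n) sums 0"
  shows "a n = 0"
  using assms(2)
proof (induction n arbitrary: a)
  case (0 a)
  have "((\<lambda>_::real. 0) \<longlongrightarrow> a 0) (at 0)"
    using powser_limit_0_strong[OF \<open>0 < r\<close>, of a "\<lambda>_. 0"] 0 by auto
  then show ?case by (simp add: tendsto_const_iff)
next
  case (Suc n a)
  have "((\<lambda>_::real. 0) \<longlongrightarrow> a 0) (at 0)"
    using powser_limit_0_strong[OF \<open>0 < r\<close>, of a "\<lambda>_. 0"] Suc.prems by auto
  then have a0: "a 0 = 0" by (simp add: tendsto_const_iff)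
  show ?case
  proof (rule Suc.IH)
    fix x :: real assume x: "x \<noteq> 0" "norm x < r"
    have "(\<lambda>n. a (Suc n) * x ^ Suc n) sums 0"
      using Suc.prems[OF x] sums_Suc_iff[of "\<lambda>n. a n * x ^ n" 0] a0 by simp
    from sums_mult[OF this, of "inverse x"] x show "(\<lambda>n. a (Suc n) * x ^ n) sums 0"
      by (simp add: field_simps)
  qed
qed

text \<open>The exponential series may be integrated termwise: as \<open>T\<close> is nonnegative,
  the absolute values of its terms sum to \<open>exp (\<bar>z\<bar> * T \<omega>)\<close>, which is
  integrable.\<close>

lemma (in prob_space) moments_sums_exp:
  fixes T :: "'a \<Rightarrow> real"
  assumes [measurable]: "T \<in> borel_measurable M"
    and nonneg: "\<And>\<omega>. \<omega> \<in> space M \<Longrightarrow> 0 \<le> T \<omega>"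
    and int: "integrable M (\<lambda>\<omega>. exp (\<bar>z\<bar> * T \<omega>))"
  shows "(\<lambda>k. expectation (\<lambda>\<omega>. T \<omega> ^ k) / fact k * z ^ k) sums expectation (\<lambda>\<omega>. exp (z * T \<omega>))"
proof -
  define t where "t k \<omega> = (z * T \<omega>) ^ k /\<^sub>R fact k" for k \<omega>
  have t_sums: "(\<lambda>k. t k \<omega>) sums exp (z * T \<omega>)" for \<omega>
    unfolding t_def by (rule exp_converges)
  have norm_t: "norm (t k \<omega>) = (\<bar>z\<bar> * T \<omega>) ^ k /\<^sub>R fact k" if "\<omega> \<in> space M" for k \<omega>
    using nonneg[OF that] by (simp add: t_def abs_mult power_abs)
  have norm_sums: "(\<lambda>k. norm (t k \<omega>)) sums exp (\<bar>z\<bar> * T \<omega>)" if "\<omega> \<in> space M" for \<omega>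
    unfolding norm_t[OF that] by (rule exp_converges)
  have partial: "(\<Sum>k\<in>A. norm (t k \<omega>)) \<le> exp (\<bar>z\<bar> * T \<omega>)" if "\<omega> \<in> space M" "finite A" for \<omega> A
    using norm_sums[OF that(1)] sum_le_suminf[OF sums_summable[OF norm_sums[OF that(1)]] that(2)]
    by (simp add: sums_iff)
  have [measurable]: "t k \<in> borel_measurable M" for k
    unfolding t_def by measurable
  have int_t: "integrable M (t k)" for k
    by (rule Bochner_Integration.integrable_bound[OF int])
       (use partial[of _ "{k}"] in \<open>auto intro!: AE_I2 simp: abs_of_nonneg\<close>)
  have "(\<lambda>k. integral\<^sup>L M (t k)) sums expectation (\<lambda>\<omega>. \<Sum>k. t k \<omega>)"
  proof (rule sums_integral[OF int_t])
    show "AE \<omega> in M. summable (\<lambda>k. norm (t k \<omega>))"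
      using norm_sums by (auto intro!: AE_I2 dest: sums_summable)
    show "summable (\<lambda>k. expectation (\<lambda>\<omega>. norm (t k \<omega>)))"
    proof (rule bounded_imp_summable)
      fix n
      have "(\<Sum>k\<le>n. expectation (\<lambda>\<omega>. norm (t k \<omega>))) = expectation (\<lambda>\<omega>. \<Sum>k\<le>n. norm (t k \<omega>))"
        by (rule Bochner_Integration.integral_sum[symmetric]) (use int_t in auto)
      also have "\<dots> \<le> expectation (\<lambda>\<omega>. exp (\<bar>z\<bar> * T \<omega>))"
        by (rule integral_mono[OF _ int]) (use int_t partial in auto)
      finally show "(\<Sum>k\<le>n. expectation (\<lambda>\<omega>. norm (t k \<omega>))) \<le> expectation (\<lambda>\<omega>. exp (\<bar>z\<bar> * T \<omega>))" .
    qed auto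
  qed
  moreover have "(\<Sum>k. t k \<omega>) = exp (z * T \<omega>)" for \<omega>
    using t_sums by (simp add: sums_iff)
  moreover have "integral\<^sup>L M (t k) = expectation (\<lambda>\<omega>. T \<omega> ^ k) / fact k * z ^ k" for k
  proof -
    have "integral\<^sup>L M (t k) = expectation (\<lambda>\<omega>. z ^ k / fact k * T \<omega> ^ k)"
      by (intro Bochner_Integration.integral_cong refl) (simp add: t_def power_mult_distrib field_simps)
    then show ?thesis by simp
  qed
  ultimately show ?thesis by simp
qed

section \<open>Gaussian integrals on Euclidean spaces\<close>

text \<open>The integrand is a product over the coordinates, so the integral is a product of
  one-dimensional ones.\<close>

lemma integrable_gaussian:
  fixes c :: real
  assumes "c > 0"
  shows "integrable lborel (\<lambda>x::'a::euclidean_space. exp (- c * (norm x)\<^sup>2))"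
proof (rule integrableI_nonneg)
  \<comment> \<open>With variance 1 / (2 c) the function exp (- c x^2) is a multiple of a normal
    density.\<close>
  define \<sigma> where "\<sigma> = sqrt (1 / (2 * c))"
  have \<sigma>: "\<sigma> > 0" "2 * \<sigma>\<^sup>2 = 1 / c"
    using assms by (auto simp: \<sigma>_def)
  have "integrable lborel (\<lambda>x. sqrt (2 * pi * \<sigma>\<^sup>2) * normal_density 0 \<sigma> x)"
    using \<sigma> by (intro integrable_mult_right) auto
  also have "(\<lambda>x. sqrt (2 * pi * \<sigma>\<^sup>2) * normal_density 0 \<sigma> x) = (\<lambda>x. exp (- c * x\<^sup>2))"
    using \<sigma> by (auto simp: normal_density_def fun_eq_iff field_simps)
  finally have fin: "(\<integral>\<^sup>+x. ennreal (exp (- c * x\<^sup>2)) \<partial>lborel) < \<infinity>"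
    by (subst nn_integral_eq_integral) auto
  have "(norm x)\<^sup>2 = (\<Sum>b\<in>Basis. (x \<bullet> b)\<^sup>2)" for x :: 'a
    using euclidean_inner[of x x] unfolding power2_norm_eq_inner by (simp add: power2_eq_square)
  then have "(\<integral>\<^sup>+x. ennreal (exp (- c * (norm (x :: 'a))\<^sup>2)) \<partial>lborel)
      = (\<integral>\<^sup>+x. (\<Prod>b\<in>(Basis :: 'a set). ennreal (exp (- c * (x \<bullet> b)\<^sup>2))) \<partial>lborel)"
    by (simp add: prod_ennreal exp_sum sum_distrib_left flip: sum_negf)
  also have "\<dots> = (\<Prod>b\<in>(Basis :: 'a set). \<integral>\<^sup>+x. ennreal (exp (- c * x\<^sup>2)) \<partial>lborel)"
    by (rule nn_integral_lborel_prod) auto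
  also have "\<dots> < \<infinity>"
    using fin by (simp add: power_less_top_ennreal)
  finally show "(\<integral>\<^sup>+x. ennreal (exp (- c * (norm (x :: 'a))\<^sup>2)) \<partial>lborel) < \<infinity>" .
qed auto

text \<open>\<open>r\<close> stands for the resolvent of \<open>T\<close> at \<open>z\<close>
  applied to \<open>m\<close>; characterising it by its equation keeps matrix inverses out of the
  computation.\<close>

lemma integral_gaussian_shift:
  fixes T :: "'a::euclidean_space \<Rightarrow> 'a"
  assumes lin: "linear T" and selfadj: "\<And>x y. T x \<bullet> y = x \<bullet> T y"
    and r: "T r - z *\<^sub>R r = m"
  shows "(\<integral>x. exp (- (T x \<bullet> x)) * exp (z * (norm (x - m))\<^sup>2) \<partial>lborel)
       = (\<integral>x. exp (- (T x \<bullet> x)) * exp (z * (norm x)\<^sup>2) \<partial>lborel) * exp (z * (norm m)\<^sup>2 + z\<^sup>2 * (r \<bullet> m))"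
proof -
  define c where "c = - z *\<^sub>R r" \<comment> \<open>the centre found by completing the square\<close>
  have cont: "continuous_on UNIV T"
    using lin by (simp add: linear_continuous_on linear_linear)
  have [measurable]: "T \<in> borel_measurable borel"
    by (rule borel_measurable_continuous_onI[OF cont])
  have exponent: "- (T (c + x) \<bullet> (c + x)) + z * (norm (c + x - m))\<^sup>2
      = (- (T x \<bullet> x) + z * (norm x)\<^sup>2) + (z * (norm m)\<^sup>2 + z\<^sup>2 * (r \<bullet> m))" for x
  proof -
    have Tr: "T r = z *\<^sub>R r + m" using r by (simp add: algebra_simps)
    have T: "T (c + x) = T x - z *\<^sub>R (z *\<^sub>R r + m)"
      using lin by (simp add: c_def linear_add linear_diff linear_scale Tr)
    \<comment> \<open>Self-adjointness moves \<open>T\<close> onto \<open>r\<close>, where the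
      equation for \<open>r\<close> applies; this makes the terms linear in \<open>x\<close>
      cancel.\<close>
    have rT: "r \<bullet> T x = z * (r \<bullet> x) + m \<bullet> x"
      unfolding selfadj[symmetric] Tr by (simp add: inner_simps)
    show ?thesis
      unfolding T unfolding c_def power2_norm_eq_inner
      by (simp add: inner_simps rT inner_commute algebra_simps power2_eq_square)
  qed
  have "(\<integral>x. exp (- (T x \<bullet> x)) * exp (z * (norm (x - m))\<^sup>2) \<partial>lborel)
      = (\<integral>x. exp (- (T x \<bullet> x)) * exp (z * (norm (x - m))\<^sup>2) \<partial>distr lborel borel ((+) c))"
    by (simp add: lborel_distr_plus)
  also have "\<dots> = (\<integral>x. exp (- (T (c + x) \<bullet> (c + x)) + z * (norm (c + x - m))\<^sup>2) \<partial>lborel)"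
    by (subst integral_distr) (auto simp flip: exp_add)
  also have "\<dots> = (\<integral>x. exp (- (T x \<bullet> x)) * exp (z * (norm x)\<^sup>2) * exp (z * (norm m)\<^sup>2 + z\<^sup>2 * (r \<bullet> m)) \<partial>lborel)"
    by (simp only: exponent exp_add mult.assoc)
  finally show ?thesis by simp
qed

section \<open>Hermitian forms as real quadratic forms\<close>

text \<open>The Euclidean inner product on complex vectors is the real part of the Hermitian one.
  Through this the results on real Euclidean spaces apply to complex matrices.\<close>

lemma inner_vector_matrix_mult:
  fixes A :: "complex ^ 'n ^ 'n"
  shows "(x v* A) \<bullet> y = Re (\<Sum>i\<in>UNIV. \<Sum>j\<in>UNIV. vec_nth x i * vec_nth (vec_nth A i) j * cnj (vec_nth y j))"
proof -
  have "u \<bullet> v = Re (u * cnj v)" for u v :: complex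
    by (simp add: inner_complex_def)
  then have "(x v* A) \<bullet> y = Re (\<Sum>j\<in>UNIV. \<Sum>i\<in>UNIV. vec_nth x i * vec_nth (vec_nth A i) j * cnj (vec_nth y j))"
    by (simp only: inner_vec_def vector_matrix_mult_def vec_lambda_beta sum_distrib_left sum_distrib_right Re_sum mult_ac)
  then show ?thesis by (subst sum.swap)
qed

lemma Re_sesq: "Re (sesq A x) = (x v* A) \<bullet> x"
  by (simp add: sesq_def inner_vector_matrix_mult)

text \<open>Turns a quadratic form in \<open>v\<close> into a linear function of
  \<open>gram v\<close>, so that such terms, summed over the shifts, depend on the sum of the Gram
  matrices alone.\<close>

lemma Re_trace_mult_gram: "Re (trace (A ** gram v)) = (v v* A) \<bullet> v"
  by (simp add: inner_vector_matrix_mult trace_def gram_def matrix_matrix_mult_def mult_ac)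

lemma trace_gram: "trace (gram v) = of_real ((norm v)\<^sup>2)"
proof -
  have "trace (gram v) = (\<Sum>i\<in>UNIV. of_real ((norm (vec_nth v i))\<^sup>2))"
    unfolding trace_def gram_def
    by (intro sum.cong refl) (simp only: vec_lambda_beta complex_norm_square mult.commute)
  then show ?thesis
    by (simp add: norm_vec_def L2_set_def sum_nonneg flip: of_real_sum of_real_power)
qed

lemma gram_0 [simp]: "gram 0 = 0"
  by (simp add: gram_def vec_eq_iff)

section \<open>The precision matrix and its resolvent\<close>

lemma full_rank_covariance_imp_invertible:
  fixes S :: "complex ^ 'p ^ 'p"
  assumes "full_rank_covariance S"
  shows "invertible S"
proof -
  have "vec.dim (rows S) = CARD('p)"
    using assms unfolding full_rank_covariance_def row_rank_def_gen by blast
  then have "vec.span (rows S) = UNIV"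
    by (simp add: vec.dimension_def card_cart_basis flip: vec.dim_eq_full)
  then show ?thesis
    by (simp add: invertible_left_inverse matrix_left_invertible_span_rows_gen)
qed

lemma vector_matrix_inv:
  fixes A :: "'a::field ^ 'n ^ 'n"
  assumes "invertible A"
  shows "(x v* matrix_inv A) v* A = x"
proof -
  \<comment> \<open>\<open>matrix_inv\<close> is a choice among two-sided inverses, and
    invertibility provides a witness.\<close>
  have "matrix_inv A ** A = mat 1"
    using assms someI_ex[of "\<lambda>B. A ** B = mat 1 \<and> B ** A = mat 1"]
    by (simp add: invertible_def matrix_inv_def)
  then show ?thesis
    by (simp add: vector_matrix_mul_assoc)
qed

lemma full_rank_covariance_selfadjoint:
  assumes "full_rank_covariance S"
  shows "(x v* S) \<bullet> y = x \<bullet> (y v* S)"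
proof -
  have S: "vec_nth (vec_nth S i) j = cnj (vec_nth (vec_nth S j) i)" for i j
    using assms unfolding full_rank_covariance_def by blast
  have *: "Re (vec_nth x i * vec_nth (vec_nth S i) j * cnj (vec_nth y j))
      = Re (vec_nth y j * vec_nth (vec_nth S j) i * cnj (vec_nth x i))" for i j
    by (subst S[of i j]) (simp add: algebra_simps)
  show ?thesis
    unfolding inner_commute[of x] inner_vector_matrix_mult Re_sum
    by (subst sum.swap) (intro sum.cong refl *)
qed

text \<open>Self-adjointness of \<open>S\<close> is applied to the images of \<open>x\<close> and
  \<open>y\<close> under the inverse; each remaining product with \<open>S\<close> cancels.\<close>

lemma precision_selfadjoint:
  assumes "full_rank_covariance S"
  shows "(x v* matrix_inv S) \<bullet> y = x \<bullet> (y v* matrix_inv S)"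
  using full_rank_covariance_selfadjoint[OF assms, of "x v* matrix_inv S" "y v* matrix_inv S"]
  by (simp add: vector_matrix_inv full_rank_covariance_imp_invertible[OF assms])

lemma linear_vector_matrix_mult: "linear (\<lambda>x. x v* (A :: complex ^ 'n ^ 'm))"
  by (rule linearI)
     (simp_all add: vec_eq_iff vector_matrix_mult_def distrib_right sum.distrib scaleR_sum_right)

text \<open>Inserting \<open>T x\<close> into the form of \<open>S\<close> shows that the form of
  the inverse is nonnegative. Invertibility makes it definite, and its minimum on the compact unit
  sphere serves as \<delta>, by homogeneity.\<close>

lemma precision_coercive:
  fixes S :: "complex ^ 'p ^ 'p"
  assumes S: "full_rank_covariance S"
  shows "\<exists>\<delta>>0. \<forall>x. \<delta> * (norm x)\<^sup>2 \<le> (x v* matrix_inv S) \<bullet> x"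
proof -
  define T where "T x = x v* matrix_inv S" for x
  have lin: "linear T"
    unfolding T_def by (rule linear_vector_matrix_mult)
  note inv = vector_matrix_inv[OF full_rank_covariance_imp_invertible[OF S]]
  have sym: "T x \<bullet> y = x \<bullet> T y" for x y
    unfolding T_def by (rule precision_selfadjoint[OF S])
  have nonneg: "0 \<le> T x \<bullet> x" for x
  proof -
    have "0 \<le> (T x v* S) \<bullet> T x"
      using S unfolding full_rank_covariance_def Re_sesq by blast
    then show ?thesis by (simp add: T_def inv sym[unfolded T_def])
  qed
  have pos: "0 < T x \<bullet> x" if "x \<noteq> 0" for x
  proof (rule ccontr)
    assume "\<not> 0 < T x \<bullet> x"
    with nonneg[of x] have x0: "T x \<bullet> x = 0" by simp
    define a b where "a = T x \<bullet> T x" and "b = T (T x) \<bullet> T x"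
    have "b \<ge> 0" by (simp add: b_def nonneg)
    \<comment> \<open>a nonnegative quadratic form is minimal at \<open>x\<close>, so its derivative in direction \<open>T x\<close> vanishes\<close>
    have expand: "T (x + t *\<^sub>R T x) \<bullet> (x + t *\<^sub>R T x) = 2 * t * a + t\<^sup>2 * b" for t
      using x0 by (simp add: linear_add[OF lin] linear_scale[OF lin] inner_simps sym[of "T x" x] a_def b_def
          power2_eq_square algebra_simps)
    \<comment> \<open>The step \<open>t = - a / (b + 1)\<close> makes the value negative unless
      \<open>a = 0\<close>; the denominator is \<open>b + 1\<close> because \<open>b\<close> may be
      0.\<close>
    have "0 \<le> 2 * (- a / (b + 1)) * a + (- a / (b + 1))\<^sup>2 * b"
      using nonneg[of "x + (- a / (b + 1)) *\<^sub>R T x"] unfolding expand .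
    also have "\<dots> = - (a\<^sup>2 * (b + 2) / (b + 1)\<^sup>2)"
      using \<open>b \<ge> 0\<close> by (simp add: divide_simps power2_eq_square) (simp add: algebra_simps)
    finally have "a\<^sup>2 * (b + 2) / (b + 1)\<^sup>2 \<le> 0" by simp
    then have "a = 0"
      using \<open>b \<ge> 0\<close> by (simp add: divide_le_0_iff mult_le_0_iff)
    then have "T x = 0" by (simp add: a_def)
    then have "x = 0" using inv[of x] by (simp add: T_def)
    with that show False by simp
  qed
  have cont: "continuous_on UNIV T"
    using lin by (simp add: linear_continuous_on linear_linear)
  obtain u :: "complex ^ 'p" where u: "norm u = 1" "\<And>y. norm y = 1 \<Longrightarrow> T u \<bullet> u \<le> T y \<bullet> y"
  proof -
    have "sphere (0 :: complex ^ 'p) 1 \<noteq> {}"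
      by simp
    moreover have "continuous_on (sphere 0 1) (\<lambda>x. T x \<bullet> x)"
      by (intro continuous_on_inner continuous_on_id continuous_on_subset[OF cont]) simp
    ultimately obtain u where "u \<in> sphere 0 1" "\<forall>y\<in>sphere 0 1. T u \<bullet> u \<le> T y \<bullet> y"
      using continuous_attains_inf[OF compact_sphere] by blast
    then show ?thesis
      by (intro that[of u]) auto
  qed
  have "T u \<bullet> u * (norm x)\<^sup>2 \<le> T x \<bullet> x" for x
  proof (cases "x = 0")
    case False
    then have "T u \<bullet> u \<le> T (x /\<^sub>R norm x) \<bullet> (x /\<^sub>R norm x)"
      by (intro u(2)) simp
    also have "\<dots> = T x \<bullet> x / (norm x)\<^sup>2"
      by (simp add: linear_scale[OF lin] power2_eq_square field_simps)
    finally show ?thesis using False by (simp add: field_simps)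
  qed (simp add: linear_0[OF lin])
  moreover have "u \<noteq> 0" using u(1) by auto
  ultimately show ?thesis
    using pos[of u] by (intro exI[of _ "T u \<bullet> u"]) (auto simp: T_def)
qed

text \<open>Coercivity excludes every \<open>z < \<delta>\<close> as an eigenvalue, and in finite
  dimension a trivial kernel gives invertibility.\<close>

lemma resolvent_solves:
  fixes S :: "complex ^ 'p ^ 'p"
  assumes coercive: "\<And>x. \<delta> * (norm x)\<^sup>2 \<le> (x v* matrix_inv S) \<bullet> x" and "z < \<delta>"
    and r: "r = m v* matrix_inv (matrix_inv S - z *\<^sub>R mat 1)"
  shows "r v* matrix_inv S - z *\<^sub>R r = m"
proof -
  define Q where "Q = matrix_inv S - z *\<^sub>R mat 1"
  have Q: "x v* Q = x v* matrix_inv S - z *\<^sub>R x" for x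
  proof -
    have "x v* (z *\<^sub>R mat 1) = z *\<^sub>R (x v* mat 1)"
      unfolding vector_matrix_mult_def by (simp add: vec_eq_iff scaleR_sum_right)
    then show ?thesis by (simp add: Q_def vector_matrix_mult_diff_rdistrib)
  qed
  have "x = 0" if "x v* Q = 0" for x
  proof (rule ccontr)
    assume "x \<noteq> 0"
    have "x v* matrix_inv S = z *\<^sub>R x" using that unfolding Q by simp
    then have "\<delta> * (norm x)\<^sup>2 \<le> z * (norm x)\<^sup>2"
      using coercive[of x] by (simp add: power2_norm_eq_inner)
    with \<open>x \<noteq> 0\<close> \<open>z < \<delta>\<close> show False by simp
  qed
  \<comment> \<open>The kernel criterion concerns matrices acting on column vectors, hence the
    transpose.\<close>
  then have "\<exists>B. B ** transpose Q = mat 1"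
    by (simp add: matrix_left_invertible_ker)
  then have "invertible Q"
    by (simp add: left_invertible_transpose invertible_right_inverse)
  then show ?thesis
    using vector_matrix_inv[of Q m] unfolding Q by (simp add: r Q_def)
qed

section \<open>The moment generating function of a shifted normal vector\<close>

text \<open>The maximum with \<open>0\<close> (which \<open>ennreal\<close> takes anyway) makes the sign of \<open>det S\<close> irrelevant.\<close>

definition central_mgf :: "complex ^ 'p ^ 'p \<Rightarrow> real \<Rightarrow> real"
  where "central_mgf S z = (\<integral>x. max 0 (complex_normal_density S x) * exp (z * (norm x)\<^sup>2) \<partial>lborel)"

text \<open>Where \<open>S\<close> and I - z S are invertible, this is z Re tr ((I - z S)^(-1) M),
  the familiar noncentrality term. It is written as completing the square delivers it, and it is
  additive in \<open>M\<close>.\<close>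

definition noncentrality_exponent :: "complex ^ 'p ^ 'p \<Rightarrow> real \<Rightarrow> complex ^ 'p ^ 'p \<Rightarrow> real"
  where "noncentrality_exponent S z M =
    z * Re (trace M) + z\<^sup>2 * Re (trace (matrix_inv (matrix_inv S - z *\<^sub>R mat 1) ** M))"

lemma noncentrality_exponent_gram:
  "noncentrality_exponent S z (gram m) =
    z * (norm m)\<^sup>2 + z\<^sup>2 * ((m v* matrix_inv (matrix_inv S - z *\<^sub>R mat 1)) \<bullet> m)"
  by (simp add: noncentrality_exponent_def Re_trace_mult_gram trace_gram del: of_real_power)

lemma noncentrality_exponent_0 [simp]: "noncentrality_exponent S z 0 = 0"
  using noncentrality_exponent_gram[of S z 0] by simp

lemma noncentrality_exponent_add:
  "noncentrality_exponent S z (M + N) = noncentrality_exponent S z M + noncentrality_exponent S z N"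
  by (simp add: noncentrality_exponent_def matrix_add_ldistrib trace_add algebra_simps)

lemma noncentrality_exponent_sum:
  "noncentrality_exponent S z (sum F A) = (\<Sum>i\<in>A. noncentrality_exponent S z (F i))"
  by (induction A rule: infinite_finite_induct) (simp_all add: noncentrality_exponent_add)

text \<open>The translation formula is applied with \<open>T\<close> the precision matrix and
  \<open>r\<close> its resolvent at \<open>m\<close>. The integral that remains does not involve
  \<open>m\<close>, so one function \<open>central_mgf S\<close> serves all shifts.\<close>

lemma complex_normal_shift_mgf:
  fixes S :: "complex ^ 'p ^ 'p" and X :: "'w \<Rightarrow> complex ^ 'p"
  assumes S: "full_rank_covariance S"
    and "\<delta> > 0" and coercive: "\<And>x. \<delta> * (norm x)\<^sup>2 \<le> (x v* matrix_inv S) \<bullet> x"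
    and z: "\<bar>z\<bar> \<le> \<delta> / 4"
    and X: "distributed \<Omega> lborel X (\<lambda>x. ennreal (complex_normal_density S x))"
  shows "integrable \<Omega> (\<lambda>\<omega>. exp (z * (norm (X \<omega> - m))\<^sup>2))"
    and "(\<integral>\<omega>. exp (z * (norm (X \<omega> - m))\<^sup>2) \<partial>\<Omega>)
          = central_mgf S z * exp (noncentrality_exponent S z (gram m))"
proof -
  define T where "T x = x v* matrix_inv S" for x
  define C where "C = max 0 (1 / (pi ^ CARD('p) * Re (det S)))"
  have dens: "max 0 (complex_normal_density S x) = C * exp (- (T x \<bullet> x))" for x
    unfolding complex_normal_density_def C_def T_def Re_sesq
    by (simp add: max_def divide_simps zero_less_mult_iff mult_le_0_iff not_less)
  \<comment> \<open>Integration against a density asks for a nonnegative real function; truncation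
    at 0 leaves its \<open>ennreal\<close> image unchanged.\<close>
  have X': "distributed \<Omega> lborel X (\<lambda>x. ennreal (C * exp (- (T x \<bullet> x))))"
  proof -
    have "ennreal (max 0 c) = ennreal c" for c
      by (simp add: max_def ennreal_neg)
    with X show ?thesis by (simp flip: dens)
  qed
  have "C \<ge> 0" by (simp add: C_def)
  have lin: "linear T"
    unfolding T_def by (rule linear_vector_matrix_mult)
  have [measurable]: "T \<in> borel_measurable borel"
    by (intro borel_measurable_continuous_onI) (use lin in \<open>simp add: linear_continuous_on linear_linear\<close>)
  \<comment> \<open>Since |x - m|^2 is at most 2 |x|^2 + 2 |m|^2, the bound \<delta> / 4 on
    \<open>z\<close> uses up only half of the Gaussian decay rate \<delta>.\<close>
  have bound: "exp (- (T x \<bullet> x)) * exp (z * (norm (x - m))\<^sup>2)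
      \<le> exp (\<delta> / 2 * (norm m)\<^sup>2) * exp (- (\<delta> / 2) * (norm x)\<^sup>2)" for x
  proof -
    have "(norm (x - m))\<^sup>2 \<le> (norm x + norm m)\<^sup>2"
      by (intro power_mono norm_triangle_ineq4) simp
    also have "\<dots> \<le> 2 * (norm x)\<^sup>2 + 2 * (norm m)\<^sup>2"
      using zero_le_power2[of "norm x - norm m"] by (simp add: power2_sum power2_diff)
    finally have "\<delta> / 4 * (norm (x - m))\<^sup>2 \<le> \<delta> / 4 * (2 * (norm x)\<^sup>2 + 2 * (norm m)\<^sup>2)"
      using \<open>\<delta> > 0\<close> by (intro mult_left_mono) auto
    moreover have "z * (norm (x - m))\<^sup>2 \<le> \<delta> / 4 * (norm (x - m))\<^sup>2"
      using z by (intro mult_right_mono) auto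
    ultimately have "- (T x \<bullet> x) + z * (norm (x - m))\<^sup>2 \<le> \<delta> / 2 * (norm m)\<^sup>2 + - (\<delta> / 2) * (norm x)\<^sup>2"
      using coercive[of x] by (simp add: T_def algebra_simps)
    then show ?thesis by (simp flip: exp_add)
  qed
  have "integrable lborel (\<lambda>x. exp (- (T x \<bullet> x)) * exp (z * (norm (x - m))\<^sup>2))"
    by (rule Bochner_Integration.integrable_bound
        [OF integrable_mult_right[OF integrable_gaussian[of "\<delta> / 2"], of "exp (\<delta> / 2 * (norm m)\<^sup>2)"]])
       (use \<open>\<delta> > 0\<close> bound in auto)
  then have "integrable lborel (\<lambda>x. C * exp (- (T x \<bullet> x)) * exp (z * (norm (x - m))\<^sup>2))"
    unfolding mult.assoc by (rule integrable_mult_right)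
  then show "integrable \<Omega> (\<lambda>\<omega>. exp (z * (norm (X \<omega> - m))\<^sup>2))"
    by (subst distributed_integrable[OF X', symmetric]) (use \<open>C \<ge> 0\<close> in auto)

  define r where "r = m v* matrix_inv (matrix_inv S - z *\<^sub>R mat 1)"
  have "T r - z *\<^sub>R r = m"
    using z \<open>\<delta> > 0\<close> unfolding T_def by (intro resolvent_solves[OF coercive _ r_def]) auto
  note shift = integral_gaussian_shift[OF lin _ this]
  have "(\<integral>\<omega>. exp (z * (norm (X \<omega> - m))\<^sup>2) \<partial>\<Omega>)
      = (\<integral>x. C * exp (- (T x \<bullet> x)) * exp (z * (norm (x - m))\<^sup>2) \<partial>lborel)"
    by (subst distributed_integral[OF X', symmetric]) (use \<open>C \<ge> 0\<close> in auto)
  also have "\<dots> = C * (\<integral>x. exp (- (T x \<bullet> x)) * exp (z * (norm (x - m))\<^sup>2) \<partial>lborel)"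
    by (simp add: mult.assoc)
  also have "\<dots> = (\<integral>x. C * exp (- (T x \<bullet> x)) * exp (z * (norm x)\<^sup>2) \<partial>lborel)
      * exp (noncentrality_exponent S z (gram m))"
    unfolding noncentrality_exponent_gram
    by (subst shift) (simp_all add: T_def precision_selfadjoint[OF S] mult.assoc r_def)
  finally show "(\<integral>\<omega>. exp (z * (norm (X \<omega> - m))\<^sup>2) \<partial>\<Omega>)
      = central_mgf S z * exp (noncentrality_exponent S z (gram m))"
    unfolding central_mgf_def dens .
qed

section \<open>Moments of the trace\<close>

lemma trace_sum_gram: "trace (\<Sum>i\<in>A. gram (v i)) = of_real (\<Sum>i\<in>A. (norm (v i))\<^sup>2)"
proof -
  have "trace (0 :: complex ^ 'p ^ 'p) = 0"
    by (simp add: trace_def)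
  then show ?thesis
    by (induction A rule: infinite_finite_induct) (simp_all add: trace_add trace_gram)
qed

lemma wishart_trace_real:
  fixes W :: "'w \<Rightarrow> complex ^ 'p ^ 'p"
  assumes "wishart \<Omega> W n S M" and "\<omega> \<in> space \<Omega>"
  shows "trace (W \<omega>) = of_real (Re (trace (W \<omega>)))"
proof -
  from assms obtain X :: "nat \<Rightarrow> 'w \<Rightarrow> complex ^ 'p" and m
    where "W \<omega> = (\<Sum>i<n. gram (X i \<omega> - m i))"
    unfolding wishart_def by blast
  then have "trace (W \<omega>) = of_real (\<Sum>i<n. (norm (X i \<omega> - m i))\<^sup>2)"
    by (simp only: trace_sum_gram)
  then show ?thesis
    by simp
qed

text \<open>The trace is a sum of squared norms of independent shifted vectors, so its exponential
  factorises. Each row contributes one \<open>central_mgf S z\<close>, and the exponents of the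
  shifts add up to a function of \<open>M\<close>.\<close>

lemma wishart_moments_sums:
  fixes S :: "complex ^ 'p ^ 'p" and W :: "'w \<Rightarrow> complex ^ 'p ^ 'p"
  assumes S: "full_rank_covariance S"
    and "\<delta> > 0" and coercive: "\<And>x. \<delta> * (norm x)\<^sup>2 \<le> (x v* matrix_inv S) \<bullet> x"
    and z: "\<bar>z\<bar> \<le> \<delta> / 4"
    and W: "wishart \<Omega> W n S M"
  shows "(\<lambda>k. (\<integral>\<omega>. Re (trace (W \<omega>)) ^ k \<partial>\<Omega>) / fact k * z ^ k)
           sums (central_mgf S z ^ n * exp (noncentrality_exponent S z M))"
proof -
  interpret prob_space \<Omega> using W by (simp add: wishart_def)
  obtain X :: "nat \<Rightarrow> 'w \<Rightarrow> complex ^ 'p" and m where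
    ind: "indep_vars (\<lambda>_. borel) X {..<n}" and
    dist: "\<And>i. i < n \<Longrightarrow> distributed \<Omega> lborel (X i) (\<lambda>x. ennreal (complex_normal_density S x))" and
    M: "(\<Sum>i<n. gram (m i)) = M" and
    W_eq: "\<And>\<omega>. \<omega> \<in> space \<Omega> \<Longrightarrow> W \<omega> = (\<Sum>i<n. gram (X i \<omega> - m i))"
    using W unfolding wishart_def by blast
  define T where "T \<omega> = (\<Sum>i<n. (norm (X i \<omega> - m i))\<^sup>2)" for \<omega>
  have T_eq: "Re (trace (W \<omega>)) = T \<omega>" if "\<omega> \<in> space \<Omega>" for \<omega>
    by (simp only: W_eq[OF that] trace_sum_gram T_def Re_complex_of_real)
  have [measurable]: "X i \<in> borel_measurable \<Omega>" if "i < n" for i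
    using ind that by (auto simp: indep_vars_def)
  have T_meas: "T \<in> borel_measurable \<Omega>"
    unfolding T_def by measurable
  have exp_T: "exp (t * T \<omega>) = (\<Prod>i<n. exp (t * (norm (X i \<omega> - m i))\<^sup>2))" for t \<omega>
    by (simp add: T_def sum_distrib_left exp_sum)
  have ind': "indep_vars (\<lambda>_. borel) (\<lambda>i \<omega>. exp (t * (norm (X i \<omega> - m i))\<^sup>2)) {..<n}" for t
    by (rule indep_vars_compose2[OF ind]) measurable
  note mgf = complex_normal_shift_mgf[OF S \<open>\<delta> > 0\<close> coercive]
  have int: "integrable \<Omega> (\<lambda>\<omega>. exp (t * T \<omega>))" if "\<bar>t\<bar> \<le> \<delta> / 4" for t
    unfolding exp_T by (intro indep_vars_integrable[OF _ ind'] mgf(1)[OF that dist]) auto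
  have "(\<lambda>k. expectation (\<lambda>\<omega>. T \<omega> ^ k) / fact k * z ^ k) sums expectation (\<lambda>\<omega>. exp (z * T \<omega>))"
    by (rule moments_sums_exp[OF T_meas _ int]) (use z in \<open>auto simp: T_def sum_nonneg\<close>)
  moreover have "expectation (\<lambda>\<omega>. exp (z * T \<omega>))
      = (\<Prod>i<n. expectation (\<lambda>\<omega>. exp (z * (norm (X i \<omega> - m i))\<^sup>2)))"
    unfolding exp_T by (intro indep_vars_lebesgue_integral[OF _ ind'] mgf(1)[OF z dist]) auto
  moreover have "\<dots> = (\<Prod>i<n. central_mgf S z * exp (noncentrality_exponent S z (gram (m i))))"
    by (intro prod.cong refl mgf(2)[OF z dist]) auto
  moreover have "\<dots> = central_mgf S z ^ n * exp (noncentrality_exponent S z M)"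
    by (simp add: prod.distrib exp_sum noncentrality_exponent_sum flip: M)
  moreover have "expectation (\<lambda>\<omega>. Re (trace (W \<omega>)) ^ k) = expectation (\<lambda>\<omega>. T \<omega> ^ k)" for k
    by (intro Bochner_Integration.integral_cong refl) (simp add: T_eq)
  ultimately show ?thesis by simp
qed

section \<open>Generating functions as formal power series\<close>

text \<open>Real coefficients suit the identities above, which hold at real
  \<open>z\<close>.\<close>

definition trace_egf :: "'w measure \<Rightarrow> ('w \<Rightarrow> complex ^ 'p ^ 'p) \<Rightarrow> real fps"
  where "trace_egf \<Omega> W = Abs_fps (\<lambda>k. (\<integral>\<omega>. Re (trace (W \<omega>)) ^ k \<partial>\<Omega>) / fact k)"

lemma
  fixes S :: "complex ^ 'p ^ 'p"
  assumes S: "full_rank_covariance S"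
    and "\<delta> > 0" and coercive: "\<And>x. \<delta> * (norm x)\<^sup>2 \<le> (x v* matrix_inv S) \<bullet> x"
    and W: "wishart \<Omega> W n S M"
  shows trace_egf_conv_radius: "fps_conv_radius (trace_egf \<Omega> W) \<ge> \<delta> / 4"
    and eval_trace_egf: "\<bar>z\<bar> < \<delta> / 4 \<Longrightarrow>
      eval_fps (trace_egf \<Omega> W) z = central_mgf S z ^ n * exp (noncentrality_exponent S z M)"
proof -
  note sums = wishart_moments_sums[OF S \<open>\<delta> > 0\<close> coercive _ W]
  \<comment> \<open>Convergence at the single point \<delta> / 4 bounds the radius from
    below.\<close>
  show "fps_conv_radius (trace_egf \<Omega> W) \<ge> \<delta> / 4"
    using conv_radius_geI[OF sums_summable[OF sums[of "\<delta> / 4"]]] \<open>\<delta> > 0\<close>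
    by (simp add: fps_conv_radius_def trace_egf_def)
  assume "\<bar>z\<bar> < \<delta> / 4"
  then show "eval_fps (trace_egf \<Omega> W) z = central_mgf S z ^ n * exp (noncentrality_exponent S z M)"
    using sums[of z] by (simp add: trace_egf_def eval_fps_def sums_iff)
qed

text \<open>Identity theorem, applied to the difference of the two series.\<close>

lemma real_fps_eqI:
  fixes f g :: "real fps"
  assumes "r > 0" and "ereal r \<le> fps_conv_radius f" and "ereal r \<le> fps_conv_radius g"
    and eq: "\<And>x. \<bar>x\<bar> < r \<Longrightarrow> eval_fps f x = eval_fps g x"
  shows "f = g"
proof -
  have "fps_nth (f - g) n = 0" for n
  proof (rule powser_sums_zero_imp_coeff_zero[OF \<open>r > 0\<close>])
    fix x :: real assume x: "norm x < r"
    then have "ereal (norm x) < fps_conv_radius f" "ereal (norm x) < fps_conv_radius g"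
      by (auto intro: less_le_trans[OF _ assms(2)] less_le_trans[OF _ assms(3)])
    from sums_diff[OF this[THEN sums_eval_fps]] show "(\<lambda>n. fps_nth (f - g) n * x ^ n) sums 0"
      using x eq by (simp add: algebra_simps)
  qed
  then show ?thesis by (simp add: fps_eq_iff)
qed

text \<open>For fixed \<open>M\<close> both evaluations carry the same noncentrality factor, and the
  additional row contributes one \<open>central_mgf S z\<close>, which is the evaluation of the
  central series with one degree of freedom.\<close>

lemma trace_egf_Suc:
  fixes S :: "complex ^ 'p ^ 'p"
  assumes S: "full_rank_covariance S"
    and W: "wishart \<Omega> W n S M" and W': "wishart \<Omega>' W' (Suc n) S M"
    and W1: "wishart \<Omega>\<^sub>1 W\<^sub>1 1 S 0"
  shows "trace_egf \<Omega>' W' = trace_egf \<Omega> W * trace_egf \<Omega>\<^sub>1 W\<^sub>1"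
proof -
  obtain \<delta> where \<delta>: "\<delta> > 0" "\<And>x. \<delta> * (norm x)\<^sup>2 \<le> (x v* matrix_inv S) \<bullet> x"
    using precision_coercive[OF S] by blast
  note radius = trace_egf_conv_radius[OF S \<delta>] and eval = eval_trace_egf[OF S \<delta>]
  show ?thesis
  proof (rule real_fps_eqI)
    show "\<delta> / 4 > 0" using \<delta>(1) by simp
    show "ereal (\<delta> / 4) \<le> fps_conv_radius (trace_egf \<Omega>' W')"
      by (rule radius[OF W'])
    show "ereal (\<delta> / 4) \<le> fps_conv_radius (trace_egf \<Omega> W * trace_egf \<Omega>\<^sub>1 W\<^sub>1)"
      using radius[OF W] radius[OF W1] by (intro order.trans[OF _ fps_conv_radius_mult]) simp
  next
    fix z :: real assume z: "\<bar>z\<bar> < \<delta> / 4"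
    then have "ereal (norm z) < fps_conv_radius (trace_egf \<Omega> W)"
      "ereal (norm z) < fps_conv_radius (trace_egf \<Omega>\<^sub>1 W\<^sub>1)"
      by (auto intro: less_le_trans[OF _ radius[OF W]] less_le_trans[OF _ radius[OF W1]])
    then show "eval_fps (trace_egf \<Omega>' W') z = eval_fps (trace_egf \<Omega> W * trace_egf \<Omega>\<^sub>1 W\<^sub>1) z"
      by (simp add: eval_fps_mult eval[OF W z] eval[OF W' z] eval[OF W1 z])
  qed
qed

text \<open>Carries the real moment series to the complex series in which Sheffer sequences are
  stated.\<close>

definition fps_of_real :: "real fps \<Rightarrow> complex fps"
  where "fps_of_real f = Abs_fps (\<lambda>n. of_real (fps_nth f n))"

lemma fps_of_real_mult: "fps_of_real (f * g) = fps_of_real f * fps_of_real g"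
  by (simp add: fps_of_real_def fps_eq_iff fps_mult_nth)

lemma wishart_expectation_trace_power:
  assumes "wishart \<Omega> W n S M"
  shows "prob_space.expectation \<Omega> (\<lambda>\<omega>. trace (W \<omega>) ^ k) = fact k * fps_nth (fps_of_real (trace_egf \<Omega> W)) k"
proof -
  have "(\<integral>\<omega>. trace (W \<omega>) ^ k \<partial>\<Omega>) = (\<integral>\<omega>. of_real (Re (trace (W \<omega>)) ^ k) \<partial>\<Omega>)"
    by (intro Bochner_Integration.integral_cong refl) (simp flip: wishart_trace_real[OF assms])
  then show ?thesis
    by (simp only: integral_complex_of_real) (simp add: fps_of_real_def trace_egf_def)
qed

lemma trace_egf_nth_0:
  assumes "wishart \<Omega> W n S M"
  shows "fps_nth (fps_of_real (trace_egf \<Omega> W)) 0 = 1"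
  using assms by (simp add: wishart_def prob_space.prob_space fps_of_real_def trace_egf_def)

text \<open>The sum defining the matrix is empty, so the trace is 0, and \<open>0 ^ 0 = 1\<close>
  leaves only the constant term. This starts the induction on the degrees of freedom.\<close>

lemma trace_egf_degenerate:
  assumes "wishart \<Omega> W 0 S M"
  shows "fps_of_real (trace_egf \<Omega> W) = 1"
proof (rule fps_ext)
  fix k
  have "trace (W \<omega>) = 0" if "\<omega> \<in> space \<Omega>" for \<omega>
    using assms that by (auto simp: wishart_def trace_def)
  then have "(\<integral>\<omega>. Re (trace (W \<omega>)) ^ k \<partial>\<Omega>) = (\<integral>\<omega>. 0 ^ k \<partial>\<Omega>)"
    by (intro Bochner_Integration.integral_cong refl) simp
  also have "\<dots> = 0 ^ k"
    using assms by (simp add: wishart_def prob_space.prob_space)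
  finally show "fps_nth (fps_of_real (trace_egf \<Omega> W)) k = fps_nth 1 k"
    by (cases k) (simp_all add: fps_of_real_def trace_egf_def)
qed

section \<open>Comparison with the Sheffer generating function\<close>

text \<open>A zero shift is appended. The comparison needs two consecutive degrees of freedom with
  the same \<open>M\<close>.\<close>

lemma wishart_defined_Suc:
  fixes M :: "complex ^ 'p ^ 'p"
  assumes "wishart_defined n M"
  shows "wishart_defined (Suc n) M"
proof -
  obtain m :: "nat \<Rightarrow> complex ^ 'p" where "(\<Sum>i<n. gram (m i)) = M"
    using assms by (auto simp: wishart_defined_def)
  then have "(\<Sum>i<Suc n. gram ((m(n := 0)) i)) = M"
    by simp
  then show ?thesis
    unfolding wishart_defined_def by blast
qed

theorem corollary4:
  fixes S M :: "complex ^ 'p ^ 'p"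
    and \<Omega> :: "nat \<Rightarrow> 'w measure" and W :: "nat \<Rightarrow> 'w \<Rightarrow> complex ^ 'p ^ 'p"
    and \<Omega>' :: "nat \<Rightarrow> 'v measure" and W' :: "nat \<Rightarrow> 'v \<Rightarrow> complex ^ 'p ^ 'p"
    and s p :: "nat \<Rightarrow> complex poly"
  assumes "full_rank_covariance S"
    and "\<exists>n. wishart_defined n M"
    and "\<And>n. wishart_defined n M \<Longrightarrow> wishart (\<Omega> n) (W n) n S M"
    and "\<And>n. wishart (\<Omega>' n) (W' n) n S 0"
    and "sheffer_sequence s"
    and "\<And>n k. wishart_defined n M \<Longrightarrow>
           prob_space.expectation (\<Omega> n) (\<lambda>\<omega>. trace (W n \<omega>) ^ k) = poly (s k) (of_nat n)"
    and "associated_sequence p s"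
  shows "\<forall>k n. prob_space.expectation (\<Omega>' n) (\<lambda>\<omega>. trace (W' n \<omega>) ^ k) = poly (p k) (of_nat n)"
proof -
  \<comment> \<open>Both series are taken from the association, so that \<open>s\<close> and
    \<open>p\<close> share the same \<open>f\<close>.\<close>
  obtain g f where s: "sheffer_for s g f" and p: "sheffer_for p 1 f"
    using assms(7) by (auto simp: associated_sequence_def)
  then have f0: "fps_nth f 0 = 0" by (simp add: sheffer_for_def)
  define A where "A n = fps_of_real (trace_egf (\<Omega> n) (W n))" for n
  define B where "B n = fps_of_real (trace_egf (\<Omega>' n) (W' n))" for n
  define E where "E x = fps_exp x oo f" for x :: complex
  \<comment> \<open>Composition with \<open>f\<close> distributes over products because
    \<open>f\<close> has constant coefficient 0.\<close>
  have E_Suc: "E (of_nat (Suc n)) = E (of_nat n) * E 1" for n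
    unfolding E_def
    by (simp add: add.commute[of 1] fps_exp_add_mult fps_compose_mult_distrib[OF f0])
  have A_eq: "A n = g * E (of_nat n)" if "wishart_defined n M" for n
  proof -
    have "A n = Abs_fps (\<lambda>k. poly (s k) (of_nat n) / fact k)"
      by (rule fps_ext)
         (simp add: A_def wishart_expectation_trace_power[OF assms(3)[OF that]] flip: assms(6)[OF that])
    with s show ?thesis by (simp add: sheffer_for_def E_def)
  qed
  obtain n where n: "wishart_defined n M"
    using assms(2) by blast
  note Suc_n = wishart_defined_Suc[OF n]
  have "A n * B 1 = A (Suc n)"
    using trace_egf_Suc[OF assms(1) assms(3)[OF n] assms(3)[OF Suc_n] assms(4)[of 1]]
    by (simp add: A_def B_def fps_of_real_mult)
  also have "\<dots> = A n * E 1"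
    unfolding A_eq[OF n] A_eq[OF Suc_n] E_Suc mult.assoc ..
  finally have "A n * B 1 = A n * E 1" .
  \<comment> \<open>The constant coefficient is 1, and formal power series over a field form an
    integral domain, so \<open>A n\<close> can be cancelled.\<close>
  moreover have "A n \<noteq> 0"
    using trace_egf_nth_0[OF assms(3)[OF n]] by (auto simp: A_def)
  ultimately have B1: "B 1 = E 1" by simp
  \<comment> \<open>The recursion that was used for \<open>M\<close> is now used with noncentrality
    0; its factor \<open>B 1\<close> is already known to be \<open>E 1\<close>.\<close>
  have B_eq: "B n = E (of_nat n)" for n
  proof (induction n)
    case 0
    then show ?case
      using trace_egf_degenerate[OF assms(4)[of 0]] by (simp add: B_def E_def)
  next
    case (Suc n)
    have "B (Suc n) = B n * B 1"
      using trace_egf_Suc[OF assms(1) assms(4)[of n] assms(4)[of "Suc n"] assms(4)[of 1]]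
      by (simp add: B_def fps_of_real_mult)
    then show ?case unfolding Suc.IH B1 E_Suc .
  qed
  show ?thesis
  proof (intro allI)
    fix k n
    have "B n = Abs_fps (\<lambda>k. poly (p k) (of_nat n) / fact k)"
      using p by (simp add: B_eq E_def sheffer_for_def)
    then show "prob_space.expectation (\<Omega>' n) (\<lambda>\<omega>. trace (W' n \<omega>) ^ k) = poly (p k) (of_nat n)"
      using wishart_expectation_trace_power[OF assms(4)[of n], of k] by (simp flip: B_def)
  qed
qed

end
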